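(* Let $G$ be a group, let $c \in \mathbb{R}$, and let $\ell: G \to \mathbb{R}$ be a function such that (i) $\ell(xy) \leq \ell(x)+\ell(y)$ for all $x,y \in G$, and (ii) $\ell(x^2) \geq 2\ell(x) - c$ for all $x \in G$. Then for any $x,y \in G$ one has $\ell([x,y]) \leq 5c$.
   Context: The commutator is $[x,y] := xyx^{-1}y^{-1}$. The function $\ell$ is not assumed to be symmetric or non-negative, nor to vanish at the identity. *)

theory Defs
  imports Complex_Main "HOL-Algebra.Group"
begin

definition commutator :: "('a, 'b) monoid_scheme \<Rightarrow> 'a \<Rightarrow> 'a \<Rightarrow> 'a" where
  "commutator G x y = x \<otimes>\<^bsub>G\<^esub> y \<otimes>\<^bsub>G\<^esub> inv\<^bsub>G\<^esub> x \<otimes>\<^bsub>G\<^esub> inv\<^bsub>G\<^esub> y"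

end

theory Submission
  imports Defs
begin

text \<open>
  By \<open>\<ell>(x\<^sup>2) \<ge> 2\<ell>(x) - c\<close>, applied to \<open>x, x\<^sup>2, x\<^sup>4, \<dots>\<close>, the value \<open>\<ell>(x)\<close> exceeds the
  growth rate of \<open>\<ell>(x\<^sup>n)\<close> by at most \<open>c\<close>; hence any bound \<open>\<ell>(x\<^sup>n) \<le> na + O(1)\<close> gives
  \<open>\<ell>(x) \<le> a + c\<close> (\<open>length_le_growth_rate\<close>). Two consequences follow. First, \<open>\<ell>\<close> is a class
  function up to an error \<open>c\<close>. Second, if \<open>wy\<close> is conjugate to \<open>zw\<^sup>-\<^sup>1\<close>, then
  \<open>\<ell>(wy) \<le> (\<ell>(y) + \<ell>(z))/2 + 3c/2\<close> (\<open>length_le_midpoint\<close>): up to factors independent of \<open>n\<close>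
  in the middle and at the end, \<open>(wy)\<^sup>2\<^sup>n\<close> is \<open>(wy)\<^sup>n(zw\<^sup>-\<^sup>1)\<^sup>n\<close>; in such a product the outermost
  factors \<open>w\<close> and \<open>w\<^sup>-\<^sup>1\<close> form a conjugation, so each pair of them costs only \<open>c\<close>, and removing
  \<open>y\<close> and \<open>z\<close> from the ends leaves a product of the same shape with \<open>n - 1\<close> for \<open>n\<close>.

  Put \<open>f(m,k) = \<ell>(x\<^sup>m[x,y]\<^sup>k)\<close>. The element \<open>x\<^sup>m[x,y]\<^sup>k\<close> equals \<open>x \<cdot> x\<^sup>m\<^sup>-\<^sup>1[x,y]\<^sup>k\<close> and is conjugate,
  by \<open>y\<close>, to \<open>(y\<^sup>-\<^sup>1x\<^sup>m[x,y]\<^sup>k\<^sup>-\<^sup>1xy) \<cdot> x\<^sup>-\<^sup>1\<close>, so the midpoint inequality yields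
  \<open>f(m,k) \<le> (f(m-1,k) + f(m+1,k-1))/2 + 2c\<close> (\<open>length_commutator_step\<close>). Thus \<open>f(m,k)\<close> is at
  most \<open>2ct\<close> plus the mean of \<open>f\<close> over the position after \<open>t\<close> steps of the random walk that
  moves by \<open>(-1,0)\<close> or \<open>(1,-1)\<close> with equal probability. This walk has drift \<open>(0,-1/2)\<close> and
  fluctuations of order \<open>\<surd>t\<close>, and \<open>f\<close> grows at most linearly; starting at \<open>(0,n)\<close> and taking
  \<open>t = 2n\<close> steps therefore gives \<open>\<ell>([x,y]\<^sup>n) \<le> 4cn + o(n)\<close>, and so
  \<open>\<ell>([x,y]) \<le> 4c + c\<close>.
\<close>

section \<open>Almost homogeneous subadditive functions\<close>

text \<open>
  A real-valued function on a group that is subadditive and, up to a defect \<open>c\<close>, at least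
  doubled by squaring. The reverse inequality \<open>l (x\<^sup>2) \<le> 2 l(x)\<close> is an instance of subadditivity.
\<close>
locale almost_homogeneous_length = group G for G (structure) +
  fixes l :: "'a \<Rightarrow> real" and c :: real
  assumes subadd: "\<lbrakk>x \<in> carrier G; y \<in> carrier G\<rbrakk> \<Longrightarrow> l (x \<otimes> y) \<le> l x + l y"
    and square: "x \<in> carrier G \<Longrightarrow> 2 * l x - c \<le> l (x [^] (2::nat))"
begin

lemma one_nonneg: "0 \<le> l \<one>"
  using subadd[of \<one> \<one>] by simp

lemma defect_nonneg: "0 \<le> c"
  using one_nonneg square[of \<one>] by simp

lemma length_pow_le:
  assumes "x \<in> carrier G"
  shows "l (x [^] (n::nat)) \<le> real n * l x + l \<one>"
proof (induction n)
  case (Suc n)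
  have "l (x [^] Suc n) \<le> l (x [^] n) + l x"
    using subadd[of "x [^] n" x] assms by simp
  with Suc.IH show ?case by (simp add: algebra_simps)
qed simp

lemma length_le_pow2:
  assumes "x \<in> carrier G"
  shows "2 ^ j * l x \<le> l (x [^] (2 ^ j :: nat)) + (2 ^ j - 1) * c"
proof (induction j)
  case 0
  then show ?case using assms by simp
next
  case (Suc j)
  have "2 * l (x [^] (2 ^ j :: nat)) - c \<le> l (x [^] (2 ^ Suc j :: nat))"
    using square[of "x [^] (2 ^ j :: nat)"] assms by (simp add: nat_pow_pow mult.commute)
  with Suc.IH show ?case by (simp add: algebra_simps)
qed

text \<open>
  The proof evaluates the bound only at the exponents \<open>2 ^ Suc j\<close>. Assuming it for even exponents
  alone suits the midpoint inequality, which splits a power into two equal halves.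
\<close>
lemma length_le_growth_rate:
  assumes x: "x \<in> carrier G"
    and bound: "\<And>n::nat. l (x [^] (2 * n)) \<le> real (2 * n) * a + b"
  shows "l x \<le> a + c"
proof -
  have le: "l x \<le> a + c + b / 2 ^ Suc j" for j
  proof -
    have "2 ^ Suc j * l x \<le> (2 ^ Suc j * a + b) + (2 ^ Suc j - 1) * c"
      using length_le_pow2[OF x, of "Suc j"] bound[of "2 ^ j"] by simp
    also have "\<dots> \<le> 2 ^ Suc j * (a + c) + b"
      using defect_nonneg by (simp add: algebra_simps)
    finally show ?thesis by (simp add: field_simps)
  qed
  have "(\<lambda>j. a + c + b * (1/2) ^ Suc j) \<longlonglongrightarrow> a + c + b * 0"
    by (intro tendsto_intros LIMSEQ_Suc LIMSEQ_power_zero) simp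
  then have "(\<lambda>j. a + c + b / 2 ^ Suc j) \<longlonglongrightarrow> a + c"
    by (simp add: power_divide)
  then show ?thesis
    using le by (intro LIMSEQ_le_const) auto
qed

section \<open>Conjugates and the midpoint inequality\<close>

lemma inv_cancel_left:
  "\<lbrakk>x \<in> carrier G; y \<in> carrier G\<rbrakk> \<Longrightarrow> inv x \<otimes> (x \<otimes> y) = y"
  "\<lbrakk>x \<in> carrier G; y \<in> carrier G\<rbrakk> \<Longrightarrow> x \<otimes> (inv x \<otimes> y) = y"
  by (simp_all flip: m_assoc)

lemma conjugate_pow:
  assumes "x \<in> carrier G" "y \<in> carrier G"
  shows "(y \<otimes> x \<otimes> inv y) [^] (n::nat) = y \<otimes> x [^] n \<otimes> inv y"
  by (induction n) (use assms in \<open>simp_all add: m_assoc inv_cancel_left\<close>)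

lemma length_conjugate_le:
  assumes x: "x \<in> carrier G" and y: "y \<in> carrier G"
  shows "l (y \<otimes> x \<otimes> inv y) \<le> l x + c"
proof (rule length_le_growth_rate)
  fix n :: nat
  have "l (y \<otimes> x [^] (2 * n) \<otimes> inv y) \<le> l y + l (x [^] (2 * n)) + l (inv y)"
    using subadd[of "y \<otimes> x [^] (2 * n)" "inv y"] subadd[of y "x [^] (2 * n)"] x y by simp
  then show "l ((y \<otimes> x \<otimes> inv y) [^] (2 * n))
      \<le> real (2 * n) * l x + (l y + l (inv y) + l \<one>)"
    using length_pow_le[OF x, of "2 * n"] conjugate_pow[OF x y] by simp
qed (use x y in simp)

text \<open>
  Passing from \<open>n\<close> to \<open>n + 1\<close> costs one conjugation by \<open>w\<close>, hence \<open>c\<close> and no multiple of \<open>l w\<close>.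
\<close>
lemma length_pow_mult_pow_le:
  assumes w: "w \<in> carrier G" and y: "y \<in> carrier G" and z: "z \<in> carrier G"
    and g: "g \<in> carrier G"
  shows "l ((w \<otimes> y) [^] n \<otimes> g \<otimes> (z \<otimes> inv w) [^] n)
    \<le> real n * (l y + l z + c) + l g"
proof (induction n)
  case 0
  then show ?case using g by simp
next
  case (Suc n)
  let ?h = "(w \<otimes> y) [^] n \<otimes> g \<otimes> (z \<otimes> inv w) [^] n"
  have h: "?h \<in> carrier G" using assms by simp
  have "(w \<otimes> y) [^] Suc n \<otimes> g \<otimes> (z \<otimes> inv w) [^] Suc n
      = (w \<otimes> y) \<otimes> (w \<otimes> y) [^] n \<otimes> g \<otimes> ((z \<otimes> inv w) [^] n \<otimes> (z \<otimes> inv w))"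
    using w y nat_pow_Suc2[of "w \<otimes> y" n] by simp
  also have "\<dots> = w \<otimes> (y \<otimes> ?h \<otimes> z) \<otimes> inv w"
    using assms by (simp add: m_assoc)
  finally have "(w \<otimes> y) [^] Suc n \<otimes> g \<otimes> (z \<otimes> inv w) [^] Suc n
      = w \<otimes> (y \<otimes> ?h \<otimes> z) \<otimes> inv w" .
  then have "l ((w \<otimes> y) [^] Suc n \<otimes> g \<otimes> (z \<otimes> inv w) [^] Suc n) \<le> l (y \<otimes> ?h \<otimes> z) + c"
    using length_conjugate_le[of "y \<otimes> ?h \<otimes> z" w] h w y z by simp
  also have "l (y \<otimes> ?h \<otimes> z) \<le> l y + l ?h + l z"
    using subadd[of "y \<otimes> ?h" z] subadd[of y ?h] h y z by simp
  finally show ?case using Suc.IH by (simp add: algebra_simps)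
qed

lemma length_le_midpoint:
  assumes w: "w \<in> carrier G" and y: "y \<in> carrier G" and z: "z \<in> carrier G"
    and t: "t \<in> carrier G"
    and conj: "w \<otimes> y = t \<otimes> (z \<otimes> inv w) \<otimes> inv t"
  shows "l (w \<otimes> y) \<le> (l y + l z) / 2 + 3 / 2 * c"
proof -
  have "l (w \<otimes> y) \<le> (l y + l z + c) / 2 + c"
  proof (rule length_le_growth_rate)
    fix n :: nat
    let ?h = "(w \<otimes> y) [^] n \<otimes> t \<otimes> (z \<otimes> inv w) [^] n"
    have h: "?h \<in> carrier G" using assms by simp
    have "(w \<otimes> y) [^] (2 * n) = (w \<otimes> y) [^] n \<otimes> (w \<otimes> y) [^] n"
      using w y by (simp add: nat_pow_mult mult_2)
    also have "\<dots> = (w \<otimes> y) [^] n \<otimes> (t \<otimes> (z \<otimes> inv w) [^] n \<otimes> inv t)"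
      using conjugate_pow[of "z \<otimes> inv w" t n] w z t by (simp add: conj)
    also have "\<dots> = ?h \<otimes> inv t"
      using w y z t by (simp add: m_assoc)
    finally have "l ((w \<otimes> y) [^] (2 * n)) \<le> l ?h + l (inv t)"
      using subadd[OF h, of "inv t"] t by simp
    then show "l ((w \<otimes> y) [^] (2 * n))
        \<le> real (2 * n) * ((l y + l z + c) / 2) + (l t + l (inv t))"
      using length_pow_mult_pow_le[OF w y z t, of n] by simp
  qed (use w y in simp)
  then show ?thesis by (simp add: field_simps)
qed

section \<open>The recursive inequality for commutators\<close>

lemma commutator_closed:
  "\<lbrakk>x \<in> carrier G; y \<in> carrier G\<rbrakk> \<Longrightarrow> commutator G x y \<in> carrier G"
  by (simp add: commutator_def)

lemma length_commutator_step:
  fixes m k :: int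
  assumes x: "x \<in> carrier G" and y: "y \<in> carrier G"
  defines "f \<equiv> \<lambda>(m::int) (k::int). l (x [^] m \<otimes> commutator G x y [^] k)"
  shows "f m k \<le> (f (m - 1) k + f (m + 1) (k - 1)) / 2 + 2 * c"
proof -
  define u where "u = commutator G x y"
  have u: "u \<in> carrier G" using x y by (simp add: u_def commutator_closed)
  let ?p = "x [^] (m - 1) \<otimes> u [^] k"
  let ?v = "x [^] m \<otimes> u [^] (k - 1)"
  let ?z = "inv y \<otimes> (?v \<otimes> x) \<otimes> y"
  have p: "?p \<in> carrier G" and v: "?v \<in> carrier G" and z: "?z \<in> carrier G"
    using x y u by simp_all
  have xm: "x \<otimes> x [^] n = x [^] (n + 1)" for n :: int
    using int_pow_mult[OF x, of 1 n] x by (simp add: add.commute)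
  have xp: "x \<otimes> ?p = x [^] m \<otimes> u [^] k"
    using x u xm[of "m - 1"] by (simp flip: m_assoc)
  have uk: "u [^] k = u [^] (k - 1) \<otimes> u"
    using int_pow_mult[OF u, of "k - 1" 1] u by simp
  \<comment> \<open>Besides \<open>x \<otimes> ?p\<close>, this is the other description of \<open>x\<^sup>m u\<^sup>k\<close> that the midpoint inequality
    needs, with \<open>w = x\<close> and \<open>t = y\<close>; it absorbs the last \<open>u = x y x\<^sup>-\<^sup>1 y\<^sup>-\<^sup>1\<close>.\<close>
  have "y \<otimes> (?z \<otimes> inv x) \<otimes> inv y = ?v \<otimes> (x \<otimes> y \<otimes> inv x \<otimes> inv y)"
    using x y v by (simp add: m_assoc inv_cancel_left)
  also have "\<dots> = x [^] m \<otimes> (u [^] (k - 1) \<otimes> u)"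
    using x u by (simp add: m_assoc flip: commutator_def u_def)
  finally have conj: "x \<otimes> ?p = y \<otimes> (?z \<otimes> inv x) \<otimes> inv y"
    by (simp only: xp flip: uk)
  \<comment> \<open>Conjugating by \<open>y\<^sup>-\<^sup>1 x\<^sup>-\<^sup>1\<close> at once accounts for the outer \<open>y\<^sup>-\<^sup>1\<close> and \<open>y\<close> and moves \<open>x\<close>
    from the front to the end, so the error \<open>c\<close> arises only once.\<close>
  have "x [^] (m + 1) \<otimes> u [^] (k - 1) = x \<otimes> ?v"
    using x u xm[of m] by (simp flip: m_assoc)
  then have "?z = (inv y \<otimes> inv x) \<otimes> (x [^] (m + 1) \<otimes> u [^] (k - 1)) \<otimes> inv (inv y \<otimes> inv x)"
    using x y v by (simp add: inv_mult_group m_assoc inv_cancel_left)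
  then have "l ?z \<le> f (m + 1) (k - 1) + c"
    using length_conjugate_le[of "x [^] (m + 1) \<otimes> u [^] (k - 1)" "inv y \<otimes> inv x"] x y u
    by (simp add: f_def u_def)
  moreover have "f m k \<le> (f (m - 1) k + l ?z) / 2 + 3 / 2 * c"
    using length_le_midpoint[OF x p z y conj] unfolding xp by (simp add: f_def u_def)
  ultimately show ?thesis by (simp add: field_simps)
qed

lemma length_int_pow_le:
  assumes x: "x \<in> carrier G"
  shows "l (x [^] (m::int)) \<le> real_of_int \<bar>m\<bar> * max (l x) (l (inv x)) + l \<one>"
proof -
  have le: "l (x [^] m) \<le> real n * max (l x) (l (inv x)) + l \<one>"
    if "x [^] m = z [^] n" "z \<in> {x, inv x}" for n and z
  proof -
    have "l (x [^] m) \<le> real n * l z + l \<one>"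
      using length_pow_le[of z n] that x by auto
    also have "\<dots> \<le> real n * max (l x) (l (inv x)) + l \<one>"
      using that by (intro add_right_mono mult_left_mono) auto
    finally show ?thesis .
  qed
  show ?thesis
  proof (cases m rule: int_cases2)
    case (nonneg n)
    then show ?thesis using le[of x n] by (simp add: int_pow_int)
  next
    case (nonpos n)
    then show ?thesis using le[of "inv x" n] x by (simp add: int_pow_neg_int nat_pow_inv)
  qed
qed

end

section \<open>The random walk\<close>

text \<open>
  After \<open>t\<close> steps of size \<open>(-1,0)\<close> or \<open>(1,-1)\<close>, each with probability one half, the walk started
  at \<open>(m,k)\<close> has second moments \<open>m\<^sup>2 + t\<close> and \<open>(k - t/2)\<^sup>2 + t/4\<close>; the right-hand side is the mean
  of the quadratic bound on \<open>f\<close> at that time plus the accumulated error \<open>d t\<close>.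
\<close>
lemma random_walk_bound:
  fixes f :: "int \<Rightarrow> int \<Rightarrow> real"
  assumes step: "\<And>m k. f m k \<le> (f (m - 1) k + f (m + 1) (k - 1)) / 2 + d"
    and quadratic: "\<And>m k. f m k \<le> K + e * ((real_of_int m)\<^sup>2 + (real_of_int k)\<^sup>2)"
  shows "f m k \<le> d * real t + K
    + e * ((real_of_int m)\<^sup>2 + (real_of_int k - real t / 2)\<^sup>2 + 5 / 4 * real t)"
proof (induction t arbitrary: m k)
  case 0
  then show ?case using quadratic[of m k] by simp
next
  case (Suc t)
  show ?case
    using step[of m k] Suc.IH[of "m - 1" k] Suc.IH[of "m + 1" "k - 1"]
    by (simp add: power2_eq_square field_simps)
qed

text \<open>
  Replacing linear growth by quadratic growth with a small coefficient \<open>e\<close> makes the mean over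
  the walk exactly computable.
\<close>
lemma linear_le_quadratic:
  fixes a e s :: real
  assumes "0 < e"
  shows "a * s \<le> e * s\<^sup>2 + a\<^sup>2 / (4 * e)"
proof -
  have "0 \<le> (2 * e * s - a)\<^sup>2 / (4 * e)" using assms by simp
  also have "\<dots> = e * s\<^sup>2 - a * s + a\<^sup>2 / (4 * e)"
    using assms by (simp add: power2_eq_square field_simps)
  finally show ?thesis by simp
qed

section \<open>The bound on commutators\<close>

theorem (in almost_homogeneous_length) length_commutator_le:
  assumes x: "x \<in> carrier G" and y: "y \<in> carrier G"
  shows "l (commutator G x y) \<le> 5 * c"
proof -
  define u where "u = commutator G x y"
  have u: "u \<in> carrier G" using x y by (simp add: u_def commutator_closed)
  define f where "f = (\<lambda>(m::int) (k::int). l (x [^] m \<otimes> u [^] k))"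
  have step: "f m k \<le> (f (m - 1) k + f (m + 1) (k - 1)) / 2 + 2 * c" for m k
    using length_commutator_step[OF x y] by (simp add: f_def u_def)
  define a where "a = max (l x) (l (inv x))"
  define b where "b = max (l u) (l (inv u))"
  have linear: "f m k \<le> a * real_of_int \<bar>m\<bar> + b * real_of_int \<bar>k\<bar> + 2 * l \<one>" for m k
    using subadd[of "x [^] m" "u [^] k"] length_int_pow_le[OF x, of m] length_int_pow_le[OF u, of k] x u
    by (simp add: f_def a_def b_def mult.commute)
  have le: "l u \<le> 5 * c + 5 / 2 * e" if e: "0 < e" for e
  proof -
    define K where "K = 2 * l \<one> + a\<^sup>2 / (4 * e) + b\<^sup>2 / (4 * e)"
    have quadratic: "f m k \<le> K + e * ((real_of_int m)\<^sup>2 + (real_of_int k)\<^sup>2)" for m k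
      using linear[of m k] linear_le_quadratic[OF e, of a "real_of_int \<bar>m\<bar>"]
        linear_le_quadratic[OF e, of b "real_of_int \<bar>k\<bar>"]
      by (simp add: K_def distrib_left)
    have "l u \<le> (4 * c + 5 / 2 * e) + c"
    proof (rule length_le_growth_rate[OF u])
      fix n :: nat
      \<comment> \<open>With \<open>4n\<close> steps from \<open>(0,2n)\<close> the drift brings the second coordinate to \<open>0\<close>.\<close>
      have "f 0 (int (2 * n)) \<le> real (2 * n) * (4 * c + 5 / 2 * e) + K"
        using random_walk_bound[OF step quadratic, of 0 "int (2 * n)" "4 * n"]
        by (simp add: algebra_simps)
      then show "l (u [^] (2 * n)) \<le> real (2 * n) * (4 * c + 5 / 2 * e) + K"
        using u int_pow_int[of G u "2 * n"] by (simp add: f_def)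
    qed
    then show ?thesis by simp
  qed
  have "l u \<le> 5 * c + e" if "0 < e" for e
    using le[of "2 / 5 * e"] that by simp
  then show ?thesis
    unfolding u_def by (rule field_le_epsilon)
qed

theorem proposition2p1:
  fixes G :: "('a, 'b) monoid_scheme"
    and c :: real
    and l :: "'a \<Rightarrow> real"
  assumes "group G"
    and "\<And>x y. x \<in> carrier G \<Longrightarrow> y \<in> carrier G \<Longrightarrow> l (x \<otimes>\<^bsub>G\<^esub> y) \<le> l x + l y"
    and "\<And>x. x \<in> carrier G \<Longrightarrow> l (x [^]\<^bsub>G\<^esub> (2::nat)) \<ge> 2 * l x - c"
    and "x \<in> carrier G" and "y \<in> carrier G"
  shows "l (commutator G x y) \<le> 5 * c"
proof -
  interpret group G by fact
  interpret almost_homogeneous_length G l c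
    by unfold_locales (use assms(2,3) in auto)
  show ?thesis using assms(4,5) by (rule length_commutator_le)
qed

end
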